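(* Let $q = q_n$ and $\ell = \ell_n$ be integers with $1 \le q < q+\ell \le n$ and $q^2 = o(\ell n)$ as $n\to\infty$. Then there is a degree-1 polynomial $f:\mathbb{R}^{\binom n2}\to\mathbb{R}$ that strongly separates $\mathbb{P} = \mathrm{MC}(n,q)$ and $\mathbb{Q} = \mathrm{MC}(n,q+\ell)$.
   Context: Graphs on vertex set $[n]$ are encoded as $Y \in \{\pm 1\}^{\binom{n}{2}}$, with $Y_{ij}=+1$ if edge $\{i,j\}$ is present and $-1$ otherwise. The model $\mathrm{MC}(n,q)$: each vertex independently receives a uniformly random label in $[q]$; vertices with the same label are always connected, and vertices with different labels are connected independently with probability $1/2$. A polynomial $f$ strongly separates $\mathbb{P}$ and $\mathbb{Q}$ if $\sqrt{\max\{\mathrm{Var}_{\mathbb{Q}}[f],\mathrm{Var}_{\mathbb{P}}[f]\}} = o(|\mathbb{E}_{\mathbb{P}}[f]-\mathbb{E}_{\mathbb{Q}}[f]|)$ as $n\to\infty$. *)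

theory Defs
  imports
    "HOL-Probability.Probability"
    "HOL-Library.Poly_Mapping"
    "HOL-Library.Ramsey"
    "HOL-Library.Landau_Symbols"
begin

section \<open>Real polynomials in several variables\<close>

text \<open>
  A polynomial with variables drawn from the type \<open>'x\<close> is a finitely supported map from
  monomials to coefficients, a monomial being a finitely supported exponent vector.
\<close>

type_synonym 'x mpoly = "('x \<Rightarrow>\<^sub>0 nat) \<Rightarrow>\<^sub>0 real"

definition mpoly_vars :: "'x mpoly \<Rightarrow> 'x set" where
  "mpoly_vars p = (\<Union>m\<in>Poly_Mapping.keys p. Poly_Mapping.keys m)"

definition mpoly_eval :: "'x mpoly \<Rightarrow> ('x \<Rightarrow> real) \<Rightarrow> real" where
  "mpoly_eval p y =
     (\<Sum>m\<in>Poly_Mapping.keys p. Poly_Mapping.lookup p m *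
        (\<Prod>x\<in>Poly_Mapping.keys m. y x ^ Poly_Mapping.lookup m x))"

text \<open>Total degree; the zero polynomial is given degree 0.\<close>

definition mpoly_degree :: "'x mpoly \<Rightarrow> nat" where
  "mpoly_degree p =
     Max (insert 0 ((\<lambda>m. \<Sum>x\<in>Poly_Mapping.keys m. Poly_Mapping.lookup m x) ` Poly_Mapping.keys p))"


section \<open>The random graph model\<close>

text \<open>
  The index set of the coordinates \<open>Y\<^sub>i\<^sub>j\<close>: the two-element subsets of \<open>[n] = {1..n}\<close>.
\<close>

definition vertex_pairs :: "nat \<Rightarrow> nat set set" where
  "vertex_pairs n = nsets {1..n} 2"

text \<open>
  A graph on \<open>[n]\<close> is a function \<open>Y\<close> with value \<open>1\<close> (edge) or \<open>-1\<close> (no edge) at each pair in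
  \<open>vertex_pairs n\<close>; both it and the labelling take the dummy value 0 outside their index sets.
  Meaningful for \<open>q \<ge> 1\<close> only, since \<^const>\<open>pmf_of_set\<close> is unspecified on the empty set.
\<close>

definition MC :: "nat \<Rightarrow> nat \<Rightarrow> (nat set \<Rightarrow> real) pmf" where
  "MC n q =
     Pi_pmf {1..n} 0 (\<lambda>_. pmf_of_set {1..q}) \<bind>
       (\<lambda>\<sigma> :: nat \<Rightarrow> nat. Pi_pmf (vertex_pairs n) 0
          (\<lambda>e. if \<forall>u\<in>e. \<forall>v\<in>e. \<sigma> u = \<sigma> v then return_pmf 1 else pmf_of_set {-1, 1}))"


section \<open>Strong separation\<close>

text \<open>
  The first conjunct makes explicit that the right-hand side of \<open>a\<^sub>n = o(b\<^sub>n)\<close> is eventually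
  nonzero. The library's \<open>o\<close> also holds for \<open>a\<^sub>n = b\<^sub>n = 0\<close>, so without this conjunct every
  sequence of constants would strongly separate everything.
\<close>

definition strongly_separates ::
  "(nat \<Rightarrow> 'a \<Rightarrow> real) \<Rightarrow> (nat \<Rightarrow> 'a pmf) \<Rightarrow> (nat \<Rightarrow> 'a pmf) \<Rightarrow> bool" where
  "strongly_separates f P Q \<longleftrightarrow>
     (\<forall>\<^sub>F n in sequentially.
        measure_pmf.expectation (P n) (f n) \<noteq> measure_pmf.expectation (Q n) (f n)) \<and>
     (\<lambda>n. sqrt (max (measure_pmf.variance (Q n) (f n)) (measure_pmf.variance (P n) (f n))))
       \<in> o(\<lambda>n. \<bar>measure_pmf.expectation (P n) (f n) - measure_pmf.expectation (Q n) (f n)\<bar>)"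

end

theory Submission
  imports Defs
begin

text \<open>
  Take \<open>f = \<Sum>\<^sub>e Y\<^sub>e\<close>, the signed edge count. In \<open>MC(n,q)\<close> the endpoints of a pair agree with
  probability \<open>1/q\<close>, so \<open>Y\<^sub>e\<close> has mean \<open>1/q\<close>. The agreement events of two distinct pairs are
  independent even when the pairs share a vertex, because one of the pairs has a vertex outside the
  other, whose label is uniform given all other labels. Hence the \<open>Y\<^sub>e\<close> are uncorrelated and, with
  \<open>N = (n choose 2)\<close>, the variance of \<open>f\<close> is at most \<open>N\<close>, while the means differ by
  \<open>N l / (q (q + l))\<close>. The ratio of standard deviation to mean difference is at most
  \<open>(q\<^sup>2 / l + q) / \<surd>N\<close>, which tends to 0 since \<open>q\<^sup>2 = o(l n)\<close> and \<open>l \<le> n\<close>.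
\<close>

declare One_nat_def [simp del]

section \<open>Expectations under finite products\<close>

text \<open>Finite supports make every real function integrable, so the tower rule carries no
  integrability side condition.\<close>

lemma expectation_bind_pmf_finite:
  fixes h :: "'b \<Rightarrow> real"
  assumes "finite (set_pmf p)" "\<And>x. x \<in> set_pmf p \<Longrightarrow> finite (set_pmf (f x))"
  shows "measure_pmf.expectation (p \<bind> f) h
    = measure_pmf.expectation p (\<lambda>x. measure_pmf.expectation (f x) h)"
  using assms
  by (simp add: pmf_expectation_bind[of "set_pmf p"] integral_measure_pmf[of "set_pmf p"])

lemma finite_set_Pi_pmf:
  assumes "finite A" "\<And>x. x \<in> A \<Longrightarrow> finite (set_pmf (p x))"
  shows "finite (set_pmf (Pi_pmf A dflt p))"
  using assms by (auto simp: set_Pi_pmf intro!: finite_PiE_dflt)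

text \<open>Conditioning on all coordinates but \<open>x\<close>: the coordinates are independent,
  so \<open>x\<close> may be drawn last.\<close>

lemma expectation_Pi_pmf_split:
  fixes h :: "('a \<Rightarrow> 'b) \<Rightarrow> real"
  assumes "finite A" "x \<in> A" "\<And>x. x \<in> A \<Longrightarrow> finite (set_pmf (p x))"
  shows "measure_pmf.expectation (Pi_pmf A dflt p) h
    = measure_pmf.expectation (Pi_pmf (A - {x}) dflt p)
        (\<lambda>f. measure_pmf.expectation (p x) (\<lambda>y. h (f(x := y))))"
proof -
  have "Pi_pmf A dflt p = Pi_pmf (insert x (A - {x})) dflt p"
    using assms(2) by (simp add: insert_absorb)
  also have "\<dots> = Pi_pmf (A - {x}) dflt p \<bind> (\<lambda>f. map_pmf (\<lambda>y. f(x := y)) (p x))"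
    using assms(1)
    \<comment> \<open>\<open>Pi_pmf_insert'\<close> draws the new coordinate first; commuting the
      two draws puts it last.\<close>
    by (subst Pi_pmf_insert') (auto simp: map_pmf_def intro: bind_commute_pmf)
  finally have "Pi_pmf A dflt p = Pi_pmf (A - {x}) dflt p \<bind> (\<lambda>f. map_pmf (\<lambda>y. f(x := y)) (p x))" .
  moreover have "finite (set_pmf (Pi_pmf (A - {x}) dflt p))"
    using assms by (intro finite_set_Pi_pmf) auto
  ultimately show ?thesis
    using assms by (simp add: expectation_bind_pmf_finite)
qed

lemma expectation_Pi_pmf_component:
  fixes h :: "'b \<Rightarrow> real"
  assumes "finite A" "x \<in> A"
  shows "measure_pmf.expectation (Pi_pmf A dflt p) (\<lambda>f. h (f x)) = measure_pmf.expectation (p x) h"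
proof -
  have "measure_pmf.expectation (Pi_pmf A dflt p) (\<lambda>f. h (f x))
    = measure_pmf.expectation (map_pmf (\<lambda>f. f x) (Pi_pmf A dflt p)) h"
    by simp
  then show ?thesis
    using assms by (simp add: Pi_pmf_component del: integral_map_pmf)
qed

lemma expectation_Pi_pmf_mult:
  fixes p :: "'a \<Rightarrow> real pmf"
  assumes "finite A" "x \<in> A" "y \<in> A" "x \<noteq> y" "\<And>x. x \<in> A \<Longrightarrow> finite (set_pmf (p x))"
  shows "measure_pmf.expectation (Pi_pmf A dflt p) (\<lambda>f. f x * f y)
    = measure_pmf.expectation (p x) (\<lambda>z. z) * measure_pmf.expectation (p y) (\<lambda>z. z)"
  using assms
  by (subst expectation_Pi_pmf_split[where x = x])
    (simp_all add: expectation_Pi_pmf_component[where h = "\<lambda>z. z"])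

section \<open>Agreement of labels\<close>

definition monochromatic :: "('a \<Rightarrow> 'b) \<Rightarrow> 'a set \<Rightarrow> bool" where
  "monochromatic \<sigma> e \<longleftrightarrow> (\<forall>u\<in>e. \<forall>v\<in>e. \<sigma> u = \<sigma> v)"

lemma monochromatic_doubleton [simp]: "monochromatic \<sigma> {a, b} \<longleftrightarrow> \<sigma> a = \<sigma> b"
  by (auto simp: monochromatic_def)

lemma monochromatic_upd [simp]: "a \<notin> e \<Longrightarrow> monochromatic (\<sigma>(a := y)) e = monochromatic \<sigma> e"
  by (auto simp: monochromatic_def)

abbreviation labelling :: "nat \<Rightarrow> nat \<Rightarrow> (nat \<Rightarrow> nat) pmf" where
  "labelling n q \<equiv> Pi_pmf {1..n} 0 (\<lambda>_. pmf_of_set {1..q})"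

lemma finite_set_labelling: "1 \<le> q \<Longrightarrow> finite (set_pmf (labelling n q))"
  by (intro finite_set_Pi_pmf) auto

text \<open>The proof conditions on all labels except \<open>\<sigma> a\<close>.\<close>

lemma expectation_labelling_agree:
  assumes "1 \<le> q" "a \<in> {1..n}" "b \<in> {1..n}" "a \<noteq> b"
    and g: "\<And>\<sigma> y. g (\<sigma>(a := y)) = g \<sigma>"
  shows "measure_pmf.expectation (labelling n q) (\<lambda>\<sigma>. of_bool (\<sigma> a = \<sigma> b) * g \<sigma>)
    = measure_pmf.expectation (labelling n q) g / real q"
proof -
  let ?L = "Pi_pmf ({1..n} - {a}) 0 (\<lambda>_. pmf_of_set {1..q})"
  have "measure_pmf.expectation (labelling n q) (\<lambda>\<sigma>. of_bool (\<sigma> a = \<sigma> b) * g \<sigma>)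
      = measure_pmf.expectation ?L
          (\<lambda>\<sigma>. measure_pmf.expectation (pmf_of_set {1..q}) (\<lambda>y. of_bool (y = \<sigma> b) * g \<sigma>))"
    using assms by (subst expectation_Pi_pmf_split[where x = a]) auto
  also have "\<dots> = measure_pmf.expectation ?L (\<lambda>\<sigma>. g \<sigma> / real q)"
  proof (intro integral_cong_AE)
    show "AE \<sigma> in ?L. measure_pmf.expectation (pmf_of_set {1..q}) (\<lambda>y. of_bool (y = \<sigma> b) * g \<sigma>)
        = g \<sigma> / real q"
    proof (intro AE_pmfI)
      fix \<sigma> assume "\<sigma> \<in> set_pmf ?L"
      \<comment> \<open>As \<open>b\<close> differs from \<open>a\<close>, it is still an index of
        \<open>?L\<close>, so its label is a genuine one and not the default 0. Exactly one
        \<open>y\<close> then matches it.\<close>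
      then have "\<sigma> b \<in> {1..q}"
        using assms by (auto simp: set_Pi_pmf PiE_dflt_def)
      then have "(\<Sum>y\<in>{1..q}. of_bool (y = \<sigma> b) * g \<sigma>) = g \<sigma>"
        by (simp add: of_bool_def if_distrib[of "\<lambda>x. x * _"] cong: if_cong)
      then show "measure_pmf.expectation (pmf_of_set {1..q}) (\<lambda>y. of_bool (y = \<sigma> b) * g \<sigma>)
          = g \<sigma> / real q"
        using assms(1) by (subst integral_pmf_of_set) auto
    qed
  qed auto
  also have "\<dots> = measure_pmf.expectation ?L g / real q"
    by simp
  \<comment> \<open>\<open>g\<close> ignores the label of \<open>a\<close>, so restoring that
    coordinate changes nothing.\<close>
  also have "measure_pmf.expectation ?L g = measure_pmf.expectation (labelling n q) g"
    using assms by (subst (2) expectation_Pi_pmf_split[where x = a]) auto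
  finally show ?thesis .
qed

lemma finite_vertex_pairs [simp]: "finite (vertex_pairs n)"
  by (simp add: vertex_pairs_def finite_imp_finite_nsets)

lemma card_vertex_pairs: "card (vertex_pairs n) = n choose 2"
  by (simp add: vertex_pairs_def)

lemma expectation_monochromatic:
  assumes "1 \<le> q" "e \<in> vertex_pairs n"
  shows "measure_pmf.expectation (labelling n q) (\<lambda>\<sigma>. of_bool (monochromatic \<sigma> e)) = 1 / real q"
proof -
  obtain a b where "e = {a, b}" "a \<in> {1..n}" "b \<in> {1..n}" "a \<noteq> b"
    using assms(2) unfolding vertex_pairs_def by (elim nsets2_E)
  then show ?thesis
    using expectation_labelling_agree[OF assms(1), of a n b "\<lambda>_. 1"] by simp
qed

text \<open>An endpoint \<open>a\<close> of \<open>e\<close> outside \<open>e'\<close> does not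
  affect agreement on \<open>e'\<close>, so averaging over its label splits off one factor
  \<open>1 / q\<close>.\<close>

lemma expectation_monochromatic_mult:
  assumes "1 \<le> q" "e \<in> vertex_pairs n" "e' \<in> vertex_pairs n" "e \<noteq> e'"
  shows "measure_pmf.expectation (labelling n q)
    (\<lambda>\<sigma>. of_bool (monochromatic \<sigma> e) * of_bool (monochromatic \<sigma> e')) = 1 / (real q)\<^sup>2"
proof -
  have "finite e'" "card e = card e'"
    using assms by (auto simp: vertex_pairs_def nsets_def)
  \<comment> \<open>Between finite sets of equal size, inclusion would force equality.\<close>
  then have "\<not> e \<subseteq> e'"
    using assms(4) card_subset_eq by metis
  then obtain a where a: "a \<in> e" "a \<notin> e'"
    by auto
  obtain b where b: "e = {a, b}" "a \<in> {1..n}" "b \<in> {1..n}" "a \<noteq> b"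
  proof -
    obtain c d where "e = {c, d}" "c \<in> {1..n}" "d \<in> {1..n}" "c \<noteq> d"
      using assms(2) unfolding vertex_pairs_def by (elim nsets2_E)
    then show ?thesis
      using a(1) that[of c] that[of d] by (auto simp: insert_commute)
  qed
  show ?thesis
    using expectation_labelling_agree[OF assms(1) b(2-4), of "\<lambda>\<sigma>. of_bool (monochromatic \<sigma> e')"]
      a(2) expectation_monochromatic[OF assms(1,3)]
    by (simp add: b(1) power2_eq_square)
qed

section \<open>Moments of the signed edge count\<close>

text \<open>The conditional law of \<open>Y e\<close> given the labelling.\<close>

definition edge_pmf :: "(nat \<Rightarrow> nat) \<Rightarrow> nat set \<Rightarrow> real pmf" where
  "edge_pmf \<sigma> e = (if monochromatic \<sigma> e then return_pmf 1 else pmf_of_set {-1, 1})"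

lemma MC_altdef: "MC n q = labelling n q \<bind> (\<lambda>\<sigma>. Pi_pmf (vertex_pairs n) 0 (edge_pmf \<sigma>))"
  by (simp add: MC_def edge_pmf_def[abs_def] monochromatic_def)

lemma set_edge_pmf: "set_pmf (edge_pmf \<sigma> e) \<subseteq> {-1, 1}"
  by (simp add: edge_pmf_def)

lemma finite_set_edge_pmf [simp]: "finite (set_pmf (edge_pmf \<sigma> e))"
  by (rule finite_subset[OF set_edge_pmf]) simp

text \<open>A fair sign has mean 0, so only the forced edges contribute.\<close>

lemma expectation_edge_pmf:
  "measure_pmf.expectation (edge_pmf \<sigma> e) (\<lambda>z. z) = of_bool (monochromatic \<sigma> e)"
  by (simp add: edge_pmf_def integral_pmf_of_set)

lemma finite_set_MC: "1 \<le> q \<Longrightarrow> finite (set_pmf (MC n q))"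
  by (auto simp: MC_altdef finite_set_labelling finite_set_Pi_pmf)

lemma expectation_MC:
  fixes h :: "(nat set \<Rightarrow> real) \<Rightarrow> real"
  assumes "1 \<le> q"
  shows "measure_pmf.expectation (MC n q) h = measure_pmf.expectation (labelling n q)
    (\<lambda>\<sigma>. measure_pmf.expectation (Pi_pmf (vertex_pairs n) 0 (edge_pmf \<sigma>)) h)"
  using assms unfolding MC_altdef
  by (intro expectation_bind_pmf_finite finite_set_labelling finite_set_Pi_pmf) auto

lemma expectation_MC_edge:
  assumes "1 \<le> q" "e \<in> vertex_pairs n"
  shows "measure_pmf.expectation (MC n q) (\<lambda>Y. Y e) = 1 / real q"
  using assms
  by (simp add: expectation_MC expectation_Pi_pmf_component[where h = "\<lambda>z. z"]
      expectation_edge_pmf expectation_monochromatic)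

text \<open>Given the labelling, distinct edges are independent, so the conditional mean is the
  product of the two agreement indicators.\<close>

lemma expectation_MC_edge_mult:
  assumes "1 \<le> q" "e \<in> vertex_pairs n" "e' \<in> vertex_pairs n" "e \<noteq> e'"
  shows "measure_pmf.expectation (MC n q) (\<lambda>Y. Y e * Y e') = 1 / (real q)\<^sup>2"
  using assms
  by (simp add: expectation_MC expectation_Pi_pmf_mult expectation_edge_pmf
      expectation_monochromatic_mult)

lemma expectation_MC_edge_square:
  assumes "1 \<le> q" "e \<in> vertex_pairs n"
  shows "measure_pmf.expectation (MC n q) (\<lambda>Y. Y e * Y e) = 1"
proof -
  have "Y e * Y e = 1" if "Y \<in> set_pmf (MC n q)" for Y
  proof -
    obtain \<sigma> where "Y \<in> set_pmf (Pi_pmf (vertex_pairs n) 0 (edge_pmf \<sigma>))"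
      using \<open>Y \<in> set_pmf (MC n q)\<close> by (auto simp: MC_altdef)
    \<comment> \<open>The default 0 is excluded because \<open>e\<close> is an index.\<close>
    then have "Y e \<in> {-1, 1}"
      using assms(2) set_edge_pmf[of \<sigma> e] by (auto simp: set_Pi_pmf PiE_dflt_def)
    then show ?thesis
      by auto
  qed
  then have "measure_pmf.expectation (MC n q) (\<lambda>Y. Y e * Y e)
      = measure_pmf.expectation (MC n q) (\<lambda>Y. 1)"
    by (intro integral_cong_AE) (auto intro: AE_pmfI)
  then show ?thesis
    by simp
qed

lemma expectation_MC_edge_sum:
  assumes "1 \<le> q"
  shows "measure_pmf.expectation (MC n q) (\<lambda>Y. \<Sum>e\<in>vertex_pairs n. Y e) = real (n choose 2) / real q"
  using assms
  by (simp add: integrable_measure_pmf_finite finite_set_MC expectation_MC_edge card_vertex_pairs)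

lemma variance_MC_edge_sum:
  assumes "1 \<le> q"
  shows "measure_pmf.variance (MC n q) (\<lambda>Y. \<Sum>e\<in>vertex_pairs n. Y e) \<le> real (n choose 2)"
proof -
  let ?V = "vertex_pairs n" and ?E = "measure_pmf.expectation (MC n q)"
  let ?N = "real (n choose 2)"
  have int: "integrable (MC n q) h" for h :: "_ \<Rightarrow> real"
    by (intro integrable_measure_pmf_finite finite_set_MC assms)
  have "?E (\<lambda>Y. (\<Sum>e\<in>?V. Y e)\<^sup>2) = (\<Sum>e\<in>?V. \<Sum>e'\<in>?V. ?E (\<lambda>Y. Y e * Y e'))"
    by (simp add: power2_eq_square sum_product int)
  \<comment> \<open>The constant part sums to the squared mean; only the diagonal correction
    survives in the variance.\<close>
  also have "\<dots> = (\<Sum>e\<in>?V. \<Sum>e'\<in>?V. 1 / (real q)\<^sup>2 + (if e = e' then 1 - 1 / (real q)\<^sup>2 else 0))"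
    using assms by (intro sum.cong refl)
      (auto simp: expectation_MC_edge_square expectation_MC_edge_mult)
  also have "\<dots> = ?N * (?N / (real q)\<^sup>2 + (1 - 1 / (real q)\<^sup>2))"
    by (simp add: sum.distrib card_vertex_pairs distrib_left)
  finally have "measure_pmf.variance (MC n q) (\<lambda>Y. \<Sum>e\<in>?V. Y e)
      = ?N * (?N / (real q)\<^sup>2 + (1 - 1 / (real q)\<^sup>2)) - (?N / real q)\<^sup>2"
    by (subst measure_pmf.variance_eq[OF int int]) (simp only: expectation_MC_edge_sum[OF assms])
  also have "\<dots> = ?N - ?N / (real q)\<^sup>2"
    by (simp add: field_simps power2_eq_square)
  finally show ?thesis
    by simp
qed

section \<open>The signed edge count as a polynomial\<close>

text \<open>The inner \<open>single\<close> is the exponent vector of the variable \<open>x\<close>,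
  the outer one gives it coefficient 1.\<close>

definition linear_mpoly :: "'x set \<Rightarrow> 'x mpoly" where
  "linear_mpoly A = (\<Sum>x\<in>A. Poly_Mapping.single (Poly_Mapping.single x 1) 1)"

lemma single_one_eq_iff [simp]:
  "Poly_Mapping.single x (1::nat) = Poly_Mapping.single y 1 \<longleftrightarrow> x = y"
  by (metis lookup_single_eq lookup_single_not_eq zero_neq_one)

text \<open>Distinct variables are distinct monomials, so no coefficients add up.\<close>

lemma lookup_linear_mpoly:
  "finite A \<Longrightarrow> Poly_Mapping.lookup (linear_mpoly A) m
    = of_bool (m \<in> (\<lambda>x. Poly_Mapping.single x 1) ` A)"
  by (induction A rule: finite_induct)
    (auto simp: linear_mpoly_def lookup_add lookup_single when_def)

lemma keys_linear_mpoly: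
  "finite A \<Longrightarrow> Poly_Mapping.keys (linear_mpoly A) = (\<lambda>x. Poly_Mapping.single x 1) ` A"
  by (auto simp: in_keys_iff lookup_linear_mpoly)

lemma mpoly_vars_linear: "finite A \<Longrightarrow> mpoly_vars (linear_mpoly A) = A"
  by (simp add: mpoly_vars_def keys_linear_mpoly)

lemma mpoly_degree_linear: "finite A \<Longrightarrow> A \<noteq> {} \<Longrightarrow> mpoly_degree (linear_mpoly A) = 1"
  by (simp add: mpoly_degree_def keys_linear_mpoly image_image)

lemma mpoly_eval_linear: "finite A \<Longrightarrow> mpoly_eval (linear_mpoly A) = (\<lambda>y. \<Sum>x\<in>A. y x)"
  by (simp add: fun_eq_iff mpoly_eval_def keys_linear_mpoly lookup_linear_mpoly sum.reindex inj_on_def)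

section \<open>Asymptotics\<close>

lemma ratio_tendsto_0:
  fixes q l :: "nat \<Rightarrow> nat"
  assumes range: "\<forall>\<^sub>F n in sequentially. 1 \<le> q n \<and> q n < q n + l n \<and> q n + l n \<le> n"
    and growth: "(\<lambda>n. (real (q n))\<^sup>2) \<in> o(\<lambda>n. real (l n) * real n)"
  shows "(\<lambda>n. ((real (q n))\<^sup>2 / real (l n) + real (q n)) / real n) \<longlonglongrightarrow> 0"
proof -
  let ?r = "\<lambda>n. (real (q n))\<^sup>2 / (real (l n) * real n)"
  have r: "?r \<longlonglongrightarrow> 0"
    by (rule smalloD_tendsto[OF growth])
  then have bound: "(\<lambda>n. ?r n + sqrt (?r n)) \<longlonglongrightarrow> 0 + sqrt 0"
    by (intro tendsto_intros)
  show ?thesis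
  proof (rule tendsto_sandwich[OF _ _ tendsto_const])
    show "\<forall>\<^sub>F n in sequentially. ((real (q n))\<^sup>2 / real (l n) + real (q n)) / real n \<le> ?r n + sqrt (?r n)"
      using range
    proof eventually_elim
      case (elim n)
      \<comment> \<open>Here \<open>l n \<le> n\<close> enters: the denominator \<open>n * n\<close>
        is at least \<open>l n * n\<close>. This controls the summand \<open>q / n\<close> by
        \<open>sqrt (?r n)\<close>; the other summand is \<open>?r n\<close> itself.\<close>
      have "(real (q n) / real n)\<^sup>2 \<le> ?r n"
        unfolding power_divide power2_eq_square[of "real n"]
        using elim by (intro divide_left_mono mult_right_mono) auto
      then have "real (q n) / real n \<le> sqrt (?r n)"
        by (rule real_le_rsqrt)
      then show ?case
        by (simp add: add_divide_distrib)
    qed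
  qed (use bound in auto)
qed

text \<open>Stated as a product rather than a quotient, so that the bound also shows the mean
  difference to be nonzero.\<close>

lemma separation_le:
  fixes n q l :: nat
  assumes "2 \<le> n" "1 \<le> q" "1 \<le> l"
  defines "N \<equiv> real (n choose 2)"
  shows "sqrt N \<le> 2 * (((real q)\<^sup>2 / real l + real q) / real n) * \<bar>N / real q - N / real (q + l)\<bar>"
proof -
  have N: "N = real n * (real n - 1) / 2"
    unfolding N_def using assms(1) by (simp add: choose_two real_of_nat_div of_nat_diff)
  \<comment> \<open>For positive \<open>n\<close> this amounts to \<open>n \<ge> 2\<close>.\<close>
  have "(real n / 2)\<^sup>2 \<le> N"
    using assms(1) unfolding N power2_eq_square by (simp add: field_simps)
  then have n: "real n / 2 \<le> sqrt N"
    by (rule real_le_rsqrt)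
  have "0 \<le> N" by (simp add: N_def)
  define s where "s = real (q + l)"
  have "0 < s"
    using assms(2) by (simp add: s_def)
  have "N / real q - N / s = N * real l / (real q * s)"
    using assms(2) by (simp add: s_def field_simps)
  moreover have "(real q)\<^sup>2 / real l + real q = real q * s / real l"
    using assms(3) by (simp add: s_def field_simps power2_eq_square)
  \<comment> \<open>The factors \<open>q * s / l\<close> and \<open>l / (q * s)\<close>
    cancel.\<close>
  ultimately have "2 * (((real q)\<^sup>2 / real l + real q) / real n) * \<bar>N / real q - N / s\<bar>
      = 2 * N / real n"
    using assms(2,3) \<open>0 \<le> N\<close> \<open>0 < s\<close> by (simp add: field_simps)
  moreover have "sqrt N * (real n / 2) \<le> sqrt N * sqrt N"
    using n \<open>0 \<le> N\<close> by (intro mult_left_mono) auto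
  ultimately show ?thesis
    using assms(1) \<open>0 \<le> N\<close> by (simp add: s_def field_simps)
qed

theorem theorem2p9:
  fixes q l :: "nat \<Rightarrow> nat"
  assumes range: "\<forall>\<^sub>F n in sequentially. 1 \<le> q n \<and> q n < q n + l n \<and> q n + l n \<le> n"
    and growth: "(\<lambda>n. (real (q n))\<^sup>2) \<in> o(\<lambda>n. real (l n) * real n)"
  shows "\<exists>f :: nat \<Rightarrow> (nat set) mpoly.
           (\<forall>n\<ge>2. mpoly_vars (f n) \<subseteq> vertex_pairs n \<and> mpoly_degree (f n) = 1) \<and>
           strongly_separates (\<lambda>n. mpoly_eval (f n)) (\<lambda>n. MC n (q n)) (\<lambda>n. MC n (q n + l n))"
proof (intro exI[of _ "\<lambda>n. linear_mpoly (vertex_pairs n)"] conjI allI impI)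
  fix n :: nat assume "2 \<le> n"
  \<comment> \<open>Without a pair the sum would be the zero polynomial, of degree 0.\<close>
  then have "card (vertex_pairs n) \<noteq> 0"
    by (simp add: card_vertex_pairs)
  then have "vertex_pairs n \<noteq> {}"
    by auto
  then show "mpoly_vars (linear_mpoly (vertex_pairs n)) \<subseteq> vertex_pairs n"
    "mpoly_degree (linear_mpoly (vertex_pairs n)) = 1"
    by (simp_all add: mpoly_vars_linear mpoly_degree_linear)
next
  let ?f = "\<lambda>n. mpoly_eval (linear_mpoly (vertex_pairs n))"
  let ?D = "\<lambda>n. \<bar>measure_pmf.expectation (MC n (q n)) (?f n)
    - measure_pmf.expectation (MC n (q n + l n)) (?f n)\<bar>"
  let ?S = "\<lambda>n. sqrt (max (measure_pmf.variance (MC n (q n + l n)) (?f n))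
    (measure_pmf.variance (MC n (q n)) (?f n)))"
  let ?r = "\<lambda>n. 2 * (((real (q n))\<^sup>2 / real (l n) + real (q n)) / real n)"
  have D: "\<forall>\<^sub>F n in sequentially. sqrt (real (n choose 2)) \<le> ?r n * ?D n"
    using range eventually_ge_at_top[of 2]
  proof eventually_elim
    case (elim n)
    then show ?case
      using separation_le[of n "q n" "l n"] by (simp add: mpoly_eval_linear expectation_MC_edge_sum)
  qed
  have "\<forall>\<^sub>F n in sequentially. measure_pmf.expectation (MC n (q n)) (?f n)
      \<noteq> measure_pmf.expectation (MC n (q n + l n)) (?f n)"
    using D eventually_ge_at_top[of 2]
  proof eventually_elim
    case (elim n)
    then have "0 < sqrt (real (n choose 2))"
      by simp
    \<comment> \<open>Equal means would make the right-hand side of \<open>D\<close> zero.\<close>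
    with elim(1) show ?case
      by auto
  qed
  moreover have "?S \<in> o(?D)"
  proof (rule landau_o.smallI)
    fix c :: real assume "0 < c"
    have "?r \<longlonglongrightarrow> 2 * 0"
      by (intro tendsto_intros ratio_tendsto_0 range growth)
    then have "\<forall>\<^sub>F n in sequentially. ?r n < c"
      using \<open>0 < c\<close> by (intro order_tendstoD(2)) auto
    then show "\<forall>\<^sub>F n in sequentially. norm (?S n) \<le> c * norm (?D n)"
      using D range
    proof eventually_elim
      case (elim n)
      \<comment> \<open>The variance bound does not depend on the number of labels, so it covers
        both models.\<close>
      have "?S n \<le> sqrt (real (n choose 2))"
        using elim(3) by (simp add: mpoly_eval_linear variance_MC_edge_sum)
      also have "\<dots> \<le> ?r n * ?D n"
        by (rule elim(2))
      also have "\<dots> \<le> c * ?D n"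
        using elim(1) by (intro mult_right_mono) auto
      finally have "?S n \<le> c * ?D n" .
      moreover have "0 \<le> ?S n"
        by (simp add: le_max_iff_disj measure_pmf.variance_positive)
      ultimately show ?case
        by simp
    qed
  qed
  ultimately show "strongly_separates ?f (\<lambda>n. MC n (q n)) (\<lambda>n. MC n (q n + l n))"
    unfolding strongly_separates_def by blast
qed

end
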